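(* Let $(A_0,A_1)$ be a compatible couple of Banach spaces and $f\in A_0+A_1$. Let $\theta\in(0,1)$, let $q\in\mathcal{P}(\mathbb{R})$ be log-Hölder continuous both at the origin and at infinity, let $f\in (A_0,A_1)_{\theta,q(\cdot)}$, and put $\alpha_v=K(2^v,f)$ for $v\in\mathbb{Z}$. Then $$\|f\|_{(A_0,A_1)_{\theta,q(\cdot)}}\approx\Big(\sum_{v=-\infty}^{0}2^{-v\theta q(0)}\alpha_v^{q(0)}\Big)^{\frac1{q(0)}}+\Big(\sum_{v=1}^{\infty}2^{-v\theta q_\infty}\alpha_v^{q_\infty}\Big)^{\frac1{q_\infty}}.$$ Moreover, $$\|f\|_{(A_0,A_1)_{\theta,q(\cdot)}}\approx\Big(\int_0^1 t^{-\theta q(0)}K(t,f)^{q(0)}\frac{dt}{t}\Big)^{\frac1{q(0)}}+\Big(\int_1^\infty t^{-\theta q_\infty}K(t,f)^{q_\infty}\frac{dt}{t}\Big)^{\frac1{q_\infty}}.$$ Here $\approx$ means two-sided inequalities with positive constants independent of $f$.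
   Context: Banach spaces $A_0,A_1$ (over $\mathbb{R}$ or $\mathbb{C}$) form a compatible couple $(A_0,A_1)$ if both embed continuously in a common Hausdorff topological vector space. $A_0+A_1$ is the set of $f=f_0+f_1$ with $f_i\in A_i$, normed by $\inf_{f=f_0+f_1}(\|f_0\|_{A_0}+\|f_1\|_{A_1})$. The $K$-functional is $K(t,f)=K(t,f,A_0,A_1)=\inf_{f=f_0+f_1}(\|f_0\|_{A_0}+t\|f_1\|_{A_1})$ for $t>0$, $f\in A_0+A_1$, the infimum being over $f_0\in A_0$, $f_1\in A_1$. $\mathcal{P}(\mathbb{R})$ is the set of measurable functions $q:\mathbb{R}\to[1,\infty)$. For measurable $g$ on $(0,\infty)$, $\|g\|_{L^{q(\cdot)}((0,\infty),\frac{dt}{t})}=\inf\{\lambda>0:\int_0^\infty |g(t)/\lambda|^{q(t)}\frac{dt}{t}\le 1\}$. $q$ is log-Hölder continuous at the origin if there is $c>0$ with $|q(x)-q(0)|\le c/\ln(e+1/|x|)$ for all $x$; it is log-Hölder continuous at infinity if there are $q_\infty\in\mathbb{R}$ and $c>0$ with $|q(x)-q_\infty|\le c/\log(e+|x|)$ for all $x$. The space $(A_0,A_1)_{\theta,q(\cdot)}$ consists of all $f\in A_0+A_1$ for which $\|f\|_{(A_0,A_1)_{\theta,q(\cdot)}}=\|t^{-\theta}K(t,f)\|_{L^{q(\cdot)}((0,\infty),\frac{dt}{t})}$ is finite. *)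

theory Defs
  imports "HOL-Analysis.Analysis"
begin

class hausdorff_tvs = real_vector + topological_ab_group_add + t2_space +
  assumes tendsto_scaleR_Pair:
    "LIM x (nhds a \<times>\<^sub>F nhds b). fst x *\<^sub>R snd x :> nhds (a *\<^sub>R b)"

instance real_normed_vector \<subseteq> hausdorff_tvs
proof
  fix a :: real and b :: 'a
  show "LIM x (nhds a \<times>\<^sub>F nhds b). fst x *\<^sub>R snd x :> nhds (a *\<^sub>R b)"
    by (intro tendsto_scaleR filterlim_fst filterlim_snd)
qed

text \<open>
  A couple of Banach spaces is given by its two embeddings \<open>j0\<close>, \<open>j1\<close> into the ambient
  space; \<open>A\<^sub>i\<close> is the range of \<open>j\<^sub>i\<close>, with norm transported from the domain.
  Complex couples are included by restriction of scalars, which changes none of the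
  norms, sums or infima below.
\<close>

definition compatible_couple ::
    "('a::banach \<Rightarrow> 'z::hausdorff_tvs) \<Rightarrow> ('b::banach \<Rightarrow> 'z) \<Rightarrow> bool" where
  "compatible_couple j0 j1 \<longleftrightarrow>
     linear j0 \<and> inj j0 \<and> continuous_on UNIV j0 \<and>
     linear j1 \<and> inj j1 \<and> continuous_on UNIV j1"

definition couple_sum ::
    "('a::banach \<Rightarrow> 'z::hausdorff_tvs) \<Rightarrow> ('b::banach \<Rightarrow> 'z) \<Rightarrow> 'z set" where
  "couple_sum j0 j1 = {j0 f0 + j1 f1 | f0 f1. True}"

definition K_functional ::
    "('a::banach \<Rightarrow> 'z::hausdorff_tvs) \<Rightarrow> ('b::banach \<Rightarrow> 'z) \<Rightarrow> real \<Rightarrow> 'z \<Rightarrow> real" where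
  "K_functional j0 j1 t f = Inf {norm f0 + t * norm f1 | f0 f1. f = j0 f0 + j1 f1}"

definition variable_exponents :: "(real \<Rightarrow> real) set" where
  "variable_exponents = {q \<in> borel_measurable lebesgue. \<forall>x. 1 \<le> q x}"

text \<open>
  At \<open>x = 0\<close> the bound reads \<open>0 \<le> c\<close> (division by zero yields zero), so the value is harmless.
\<close>

definition log_Hoelder_at_origin :: "(real \<Rightarrow> real) \<Rightarrow> bool" where
  "log_Hoelder_at_origin q \<longleftrightarrow>
     (\<exists>c>0. \<forall>x. \<bar>q x - q 0\<bar> \<le> c / ln (exp 1 + 1 / \<bar>x\<bar>))"

definition log_Hoelder_at_infinity :: "(real \<Rightarrow> real) \<Rightarrow> real \<Rightarrow> bool" where
  "log_Hoelder_at_infinity q q_inf \<longleftrightarrow>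
     (\<exists>c>0. \<forall>x. \<bar>q x - q_inf\<bar> \<le> c / ln (exp 1 + \<bar>x\<bar>))"

text \<open>
  Norms, series and integrals take values in \<^typ>\<open>ennreal\<close>: the infimum of the empty set
  is \<open>\<infinity>\<close>, and a divergent series is \<open>\<infinity>\<close> rather than a default real.
\<close>

definition Luxemburg_norm :: "(real \<Rightarrow> real) \<Rightarrow> (real \<Rightarrow> real) \<Rightarrow> ennreal" where
  "Luxemburg_norm q g =
     Inf {ennreal r | r. 0 < r \<and>
       (\<integral>\<^sup>+t\<in>{0<..}. ennreal (\<bar>g t / r\<bar> powr q t / t) \<partial>lebesgue) \<le> 1}"

definition interp_norm ::
    "('a::banach \<Rightarrow> 'z::hausdorff_tvs) \<Rightarrow> ('b::banach \<Rightarrow> 'z) \<Rightarrow> real \<Rightarrow> (real \<Rightarrow> real) \<Rightarrow> 'z \<Rightarrow> ennreal" where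
  "interp_norm j0 j1 \<theta> q f = Luxemburg_norm q (\<lambda>t. t powr (-\<theta>) * K_functional j0 j1 t f)"

definition interp_space ::
    "('a::banach \<Rightarrow> 'z::hausdorff_tvs) \<Rightarrow> ('b::banach \<Rightarrow> 'z) \<Rightarrow> real \<Rightarrow> (real \<Rightarrow> real) \<Rightarrow> 'z set" where
  "interp_space j0 j1 \<theta> q = {f \<in> couple_sum j0 j1. interp_norm j0 j1 \<theta> q f < \<infinity>}"

text \<open>Only meant for exponents \<open>p > 0\<close>.\<close>

definition ennreal_powr :: "ennreal \<Rightarrow> real \<Rightarrow> ennreal" where
  "ennreal_powr x p = (if x = \<infinity> then \<infinity> else ennreal (enn2real x powr p))"

end

theory Submission
  imports Defs
begin

text \<open>
  The weight \<open>g t = t powr (-\<theta>) * K(t, f)\<close> is doubling: it changes at most by the factor \<open>2\<close>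
  on \<open>[t/2, 2 t]\<close>. Hence, if the modular of \<open>h = g / r\<close> is at most \<open>1\<close>, the mass
  on a dyadic block next to \<open>t\<close> already forces \<open>h t \<le> 8\<close>. For such bounded \<open>h\<close> the exponent
  can be changed pointwise: with \<open>x = t\<close> near the origin and \<open>x = 1 / t\<close> near infinity,
  either \<open>h t \<le> x\<close>, which has a finite integral against \<open>dt / t\<close>, or log-Hoelder continuity
  bounds \<open>h t powr (q t - q 0)\<close>, respectively \<open>h t powr (q t - q_inf)\<close>. This compares the
  Luxemburg norm with the two constant-exponent integrals, and doubling compares these with the
  dyadic sums block by block.
\<close>

section \<open>Measurability, series and powers in \<open>ennreal\<close>\<close>

lemma measurable_ident_lebesgue [measurable]: "(\<lambda>x::real. x) \<in> borel_measurable lebesgue"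
  by (rule measurable_completion) simp

text \<open>This turns the sums of the theorem into integrals, so that monotonicity, constant
  factors and countable additivity come from \<open>nn_integral\<close>. For infinite
  \<open>I\<close> both sides are the same series along an enumeration.\<close>

lemma infsum_ennreal_eq_nn_integral_count_space:
  fixes f :: "'i \<Rightarrow> ennreal"
  assumes "countable I"
  shows "infsum f I = (\<integral>\<^sup>+i. f i \<partial>count_space I)"
proof (cases "finite I")
  case True
  then show ?thesis
    by (simp add: nn_integral_count_space_finite)
next
  case False
  note bij = bij_betw_from_nat_into[OF assms False]
  have "(f \<circ> from_nat_into I) summable_on UNIV"
    by (rule nonneg_summable_on_complete) simp
  then have "(f \<circ> from_nat_into I) sums infsum (f \<circ> from_nat_into I) UNIV"
    by (intro has_sum_imp_sums has_sum_infsum)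
  then have "infsum (f \<circ> from_nat_into I) UNIV = (\<Sum>n. f (from_nat_into I n))"
    by (simp add: sums_iff comp_def)
  moreover have "infsum f I = infsum (f \<circ> from_nat_into I) UNIV"
    using infsum_reindex[of "from_nat_into I" UNIV f] bij by (simp add: bij_betw_def)
  moreover have "(\<integral>\<^sup>+i. f i \<partial>count_space I) = (\<Sum>n. f (from_nat_into I n))"
    by (simp add: nn_integral_bij_count_space[symmetric, OF bij] nn_integral_count_space_nat)
  ultimately show ?thesis by simp
qed

lemma ennreal_powr_mono:
  assumes "x \<le> y" "0 \<le> p"
  shows "ennreal_powr x p \<le> ennreal_powr y p"
  using assms
  by (auto simp: ennreal_powr_def top_unique less_top intro!: ennreal_leI powr_mono2 enn2real_mono)

lemma ennreal_powr_inverse_le_iff: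
  assumes "0 < p" "0 < r"
  shows "ennreal_powr X (1 / p) \<le> ennreal r \<longleftrightarrow> X \<le> ennreal (r powr p)"
proof (cases X)
  case top
  then show ?thesis by (simp add: ennreal_powr_def top_unique)
next
  case (real x)
  have "x powr (1 / p) \<le> r \<longleftrightarrow> x \<le> r powr p"
  proof
    assume "x powr (1 / p) \<le> r"
    then have "(x powr (1 / p)) powr p \<le> r powr p"
      using assms by (intro powr_mono2) auto
    then show "x \<le> r powr p" using assms real by (simp add: powr_powr)
  next
    assume "x \<le> r powr p"
    then have "x powr (1 / p) \<le> (r powr p) powr (1 / p)"
      using assms real by (intro powr_mono2) auto
    then show "x powr (1 / p) \<le> r" using assms by (simp add: powr_powr)
  qed
  then show ?thesis using real assms by (simp add: ennreal_powr_def)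
qed

lemma ennreal_powr_inverse_cmult_le:
  assumes "0 < p" "0 \<le> a" "X \<le> ennreal (a powr p) * Y"
  shows "ennreal_powr X (1 / p) \<le> ennreal a * ennreal_powr Y (1 / p)"
proof (cases "a = 0")
  case True
  with assms show ?thesis by (simp add: ennreal_powr_def)
next
  case False
  show ?thesis
  proof (cases Y)
    case top
    with False assms show ?thesis by (simp add: ennreal_powr_def ennreal_mult_top)
  next
    case (real y)
    have "ennreal_powr X (1 / p) \<le> ennreal_powr (ennreal (a powr p) * Y) (1 / p)"
      using assms by (intro ennreal_powr_mono) auto
    also have "\<dots> = ennreal a * ennreal_powr Y (1 / p)"
      using real assms
      by (simp add: ennreal_powr_def flip: ennreal_mult) (simp add: powr_mult powr_powr ennreal_mult)
    finally show ?thesis .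
  qed
qed

section \<open>Doubling functions and modulars for the measure dt/t\<close>

definition doubling :: "(real \<Rightarrow> real) \<Rightarrow> bool" where
  "doubling h \<longleftrightarrow>
     (\<forall>t>0. 0 \<le> h t) \<and> (\<forall>s>0. \<forall>t>0. t \<le> 2 * s \<longrightarrow> s \<le> 2 * t \<longrightarrow> h t \<le> 2 * h s)"

lemma doublingD:
  assumes "doubling h"
  shows doubling_nonneg: "0 < t \<Longrightarrow> 0 \<le> h t"
    and doubling_le: "0 < s \<Longrightarrow> 0 < t \<Longrightarrow> t \<le> 2 * s \<Longrightarrow> s \<le> 2 * t \<Longrightarrow> h t \<le> 2 * h s"
  using assms by (auto simp: doubling_def)

lemma doubling_divide:
  assumes "doubling h" "0 < r"
  shows "doubling (\<lambda>t. h t / r)"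
  using assms by (auto simp: doubling_def divide_simps)

text \<open>No absolute value is taken: the definition is meant for \<open>h\<close> that is
  nonnegative on \<open>A\<close>.\<close>

definition modular :: "real set \<Rightarrow> (real \<Rightarrow> real) \<Rightarrow> (real \<Rightarrow> real) \<Rightarrow> ennreal" where
  "modular A p h = (\<integral>\<^sup>+t\<in>A. ennreal (h t powr p t / t) \<partial>lebesgue)"

lemma modular_mono_set: "A \<subseteq> B \<Longrightarrow> modular A p h \<le> modular B p h"
  unfolding modular_def by (intro nn_integral_mono) (auto simp: indicator_def)

text \<open>Substitute for homogeneity, which a variable exponent destroys: from
  \<open>1 \<le> D\<close> and \<open>1 \<le> p t\<close> follows \<open>D \<le> D powr p t\<close>,
  so dividing \<open>h\<close> by \<open>D\<close> shrinks the integrand at least by the factor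
  \<open>D\<close>.\<close>

lemma modular_divide_le:
  assumes "A \<subseteq> {0<..}" "A \<in> sets lebesgue"
    and [measurable]: "p \<in> borel_measurable lebesgue" "h \<in> borel_measurable lebesgue"
    and p: "\<And>t. t \<in> A \<Longrightarrow> 1 \<le> p t" and h: "\<And>t. t \<in> A \<Longrightarrow> 0 \<le> h t"
    and "1 \<le> D" "modular A p h \<le> ennreal D"
  shows "modular A p (\<lambda>t. h t / D) \<le> 1"
proof -
  note [measurable] = assms(2)
  have "modular A p (\<lambda>t. h t / D) \<le>
      (\<integral>\<^sup>+t. ennreal (1 / D) * (ennreal (h t powr p t / t) * indicator A t) \<partial>lebesgue)"
    unfolding modular_def
  proof (intro nn_integral_mono)
    fix t
    show "ennreal ((h t / D) powr p t / t) * indicator A t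
        \<le> ennreal (1 / D) * (ennreal (h t powr p t / t) * indicator A t)"
    proof (cases "t \<in> A")
      case True
      with assms have t: "0 < t" by auto
      have "D powr 1 \<le> D powr p t"
        using p[OF True] assms by (intro powr_mono) auto
      then have "h t powr p t / D powr p t / t \<le> h t powr p t / D / t"
        using t assms by (intro divide_right_mono divide_left_mono) auto
      then have "(h t / D) powr p t / t \<le> 1 / D * (h t powr p t / t)"
        using h[OF True] assms by (simp add: powr_divide)
      then show ?thesis
        using True t assms by (simp add: ennreal_leI flip: ennreal_mult)
    qed simp
  qed
  also have "\<dots> = ennreal (1 / D) * modular A p h"
    unfolding modular_def by (intro nn_integral_cmult) measurable
  also have "\<dots> \<le> ennreal (1 / D) * ennreal D"
    using assms by (intro mult_left_mono) auto
  also have "\<dots> = 1"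
    using assms by (simp flip: ennreal_mult)
  finally show ?thesis .
qed

lemma modular_const_divide:
  assumes "A \<subseteq> {0<..}" "A \<in> sets lebesgue"
    and [measurable]: "h \<in> borel_measurable lebesgue"
    and h: "\<And>t. t \<in> A \<Longrightarrow> 0 \<le> h t" and "0 < r"
  shows "modular A (\<lambda>_. p) h = ennreal (r powr p) * modular A (\<lambda>_. p) (\<lambda>t. h t / r)"
proof -
  note [measurable] = assms(2)
  have "ennreal (r powr p) * modular A (\<lambda>_. p) (\<lambda>t. h t / r) =
      (\<integral>\<^sup>+t. ennreal (r powr p) * (ennreal ((h t / r) powr p / t) * indicator A t) \<partial>lebesgue)"
    unfolding modular_def by (intro nn_integral_cmult[symmetric]) measurable
  also have "\<dots> = modular A (\<lambda>_. p) h"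
    unfolding modular_def
  proof (intro nn_integral_cong)
    fix t
    show "ennreal (r powr p) * (ennreal ((h t / r) powr p / t) * indicator A t)
        = ennreal (h t powr p / t) * indicator A t"
    proof (cases "t \<in> A")
      case True
      with assms have t: "0 < t" by auto
      show ?thesis
        using True t assms h[OF True] by (simp add: powr_divide flip: ennreal_mult)
    qed simp
  qed
  finally show ?thesis by simp
qed

text \<open>Constant exponents are homogeneous, so the p-th root of the modular is itself a
  Luxemburg norm. Both kinds of norm can thus be compared through the same threshold
  \<open>r\<close>.\<close>

lemma ennreal_powr_modular_le_iff:
  assumes "A \<subseteq> {0<..}" "A \<in> sets lebesgue" "h \<in> borel_measurable lebesgue"
    and "\<And>t. t \<in> A \<Longrightarrow> 0 \<le> h t" and "0 < r" "0 < p"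
  shows "ennreal_powr (modular A (\<lambda>_. p) h) (1 / p) \<le> ennreal r
      \<longleftrightarrow> modular A (\<lambda>_. p) (\<lambda>t. h t / r) \<le> 1"
proof -
  have "ennreal (r powr p) * X \<le> ennreal (r powr p) \<longleftrightarrow> X \<le> 1" for X
    using assms ennreal_mult_le_mult_iff[of "ennreal (r powr p)" X 1] by simp
  then show ?thesis
    unfolding ennreal_powr_inverse_le_iff[OF \<open>0 < p\<close> \<open>0 < r\<close>]
    using modular_const_divide[OF assms(1-5), of p] by simp
qed

section \<open>Changing the exponent in a modular\<close>

text \<open>If \<open>8 < h t\<close>, then \<open>h\<close> is at least 4 on a neighbouring block
  from \<open>a\<close> to \<open>2 * a\<close>, and so is \<open>h s powr p s\<close> because
  \<open>1 \<le> p s\<close>. Integrating \<open>4 / (2 * a)\<close> over length \<open>a\<close>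
  gives 2, which exceeds the modular. The choice in \<open>sub\<close> is needed near the point 1:
  the left block stays inside \<open>{0<..<1}\<close>, the right block inside
  \<open>{1<..}\<close>.\<close>

lemma doubling_le_8:
  assumes h: "doubling h" and A: "A \<subseteq> {0<..}" and "t \<in> A"
    and sub: "{t / 2<..<t} \<subseteq> A \<or> {t<..<2 * t} \<subseteq> A"
    and p: "\<And>t. t \<in> A \<Longrightarrow> 1 \<le> p t" and le: "modular A p h \<le> 1"
  shows "h t \<le> 8"
proof (rule ccontr)
  assume "\<not> h t \<le> 8"
  then have "8 < h t" by simp
  have t: "0 < t" using assms by auto
  from sub obtain a where a: "t / 2 \<le> a" "a \<le> t" "{a<..<2 * a} \<subseteq> A"
    using t by (elim disjE) (force intro: that[of "t / 2"], force intro: that[of t])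
  have "4 / (2 * a) \<le> h s powr p s / s" if s: "s \<in> {a<..<2 * a}" for s
  proof -
    have "h t \<le> 2 * h s"
      using s a t by (intro doubling_le[OF h]) auto
    then have "4 \<le> h s" using \<open>8 < h t\<close> by simp
    also have "h s = h s powr 1" using calculation by simp
    also have "\<dots> \<le> h s powr p s"
      using \<open>4 \<le> h s\<close> s a p by (intro powr_mono) auto
    finally show ?thesis
      using s a t by (intro frac_le) auto
  qed
  then have "(\<integral>\<^sup>+s. ennreal (4 / (2 * a)) * indicator {a<..<2 * a} s \<partial>lebesgue) \<le> modular A p h"
    unfolding modular_def using a(3)
    by (intro nn_integral_mono) (auto simp: indicator_def intro!: ennreal_leI)
  also have "(\<integral>\<^sup>+s. ennreal (4 / (2 * a)) * indicator {a<..<2 * a} s \<partial>lebesgue) = 2"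
    using a t by (subst nn_integral_cmult_indicator) (auto simp flip: ennreal_mult)
  finally have "(2::ennreal) \<le> 1" using le by (rule order_trans)
  then show False by simp
qed

text \<open>A value \<open>h\<close> below \<open>x\<close> is absorbed by the summand
  \<open>x\<close>, since \<open>h < 1\<close> and \<open>1 \<le> p\<close>. Otherwise
  \<open>x \<le> h\<close> keeps \<open>ln h\<close> from being more negative than
  \<open>ln x\<close>, and the logarithm in \<open>pp'\<close> compensates exactly this
  size.\<close>

lemma powr_le_powr_exponent_change:
  fixes h p p' c x :: real
  assumes "0 \<le> h" "h \<le> 8" "1 \<le> p" "0 \<le> c" "0 < x" "x \<le> 1"
    and pp': "\<bar>p - p'\<bar> \<le> c / ln (exp 1 + 1 / x)"
  shows "h powr p \<le> exp (3 * c) * h powr p' + x"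
proof (cases "h < x")
  case True
  have "h powr p \<le> h powr 1"
    using assms True by (intro powr_mono') auto
  also have "\<dots> \<le> x" using True assms by simp
  finally show ?thesis by (simp add: add.commute add_increasing2)
next
  case False
  then have h: "0 < h" using assms by simp
  define L where "L = ln (exp 1 + 1 / x)"
  have "exp 1 \<le> exp 1 + 1 / x" using assms by simp
  then have "1 \<le> L"
    unfolding L_def using assms by (subst ln_ge_iff) (auto intro: add_pos_pos)
  have lnx: "- ln x \<le> L"
  proof -
    have "ln (1 / x) \<le> L"
      unfolding L_def using assms by (subst ln_le_cancel_iff) (auto intro: add_pos_pos)
    then show ?thesis using assms by (simp add: ln_div)
  qed
  have cL: "c / L \<le> c" using \<open>1 \<le> L\<close> \<open>0 \<le> c\<close> by (simp add: divide_simps mult_le_cancel_left1)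
  \<comment> \<open>For \<open>1 \<le> h\<close> the gap is at most \<open>c\<close> and
    \<open>ln h\<close> at most \<open>ln 8 \<le> 3\<close>, which is the origin of the 3. For
    \<open>h < 1\<close> the gap is at most \<open>c / L\<close> and \<open>- ln h\<close> at most
    \<open>L\<close>, so the product is at most \<open>c\<close>.\<close>
  have "(p - p') * ln h \<le> 3 * c"
  proof (cases "1 \<le> h")
    case True
    have "ln h \<le> ln (exp 3)"
    proof (subst ln_le_cancel_iff)
      have "(8::real) = 2 ^ 3" by simp
      also have "\<dots> \<le> exp 1 ^ 3" using exp_ge_add_one_self[of 1] by (intro power_mono) auto
      also have "\<dots> = exp 3" by (simp flip: exp_of_nat_mult)
      finally show "h \<le> exp 3" using assms by simp
    qed (use h in auto)
    then have "ln h \<le> 3" by simp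
    moreover have "p - p' \<le> c" using pp' cL by (simp add: L_def)
    ultimately have "(p - p') * ln h \<le> c * 3"
      using True assms by (intro mult_mono) auto
    then show ?thesis by simp
  next
    case *: False
    have "- ln h \<le> - ln x" using False assms by simp
    then have "- ln h \<le> L" using lnx by simp
    moreover have "- ln h \<ge> 0" using * h by simp
    ultimately have "(p' - p) * (- ln h) \<le> c / L * L"
      using pp' \<open>1 \<le> L\<close> assms by (intro mult_mono) (auto simp: L_def)
    then show ?thesis using \<open>1 \<le> L\<close> assms by (simp add: algebra_simps)
  qed
  then have "h powr (p - p') \<le> exp (3 * c)" using h by (simp add: powr_def)
  then have "h powr (p - p') * h powr p' \<le> exp (3 * c) * h powr p'"
    by (rule mult_right_mono) simp
  then show ?thesis using assms by (simp flip: powr_add)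
qed

text \<open>The pointwise estimate integrated against dt/t; the summand 1 is the total contribution
  of the comparison function \<open>x\<close>.\<close>

lemma modular_exponent_change:
  assumes A: "A \<subseteq> {0<..}" "A \<in> sets lebesgue"
    and [measurable]: "p' \<in> borel_measurable lebesgue" "h \<in> borel_measurable lebesgue"
      "x \<in> borel_measurable lebesgue"
    and h: "\<And>t. t \<in> A \<Longrightarrow> 0 \<le> h t" "\<And>t. t \<in> A \<Longrightarrow> h t \<le> 8"
    and p: "\<And>t. t \<in> A \<Longrightarrow> 1 \<le> p t"
    and x: "\<And>t. t \<in> A \<Longrightarrow> 0 < x t" "\<And>t. t \<in> A \<Longrightarrow> x t \<le> 1"
    and c: "0 \<le> c" and pp': "\<And>t. t \<in> A \<Longrightarrow> \<bar>p t - p' t\<bar> \<le> c / ln (exp 1 + 1 / x t)"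
    and int: "(\<integral>\<^sup>+t\<in>A. ennreal (x t / t) \<partial>lebesgue) \<le> 1"
  shows "modular A p h \<le> ennreal (exp (3 * c)) * modular A p' h + 1"
proof -
  note [measurable] = A(2)
  have "modular A p h \<le> (\<integral>\<^sup>+t. ennreal (exp (3 * c)) * (ennreal (h t powr p' t / t) * indicator A t)
      + ennreal (x t / t) * indicator A t \<partial>lebesgue)"
    unfolding modular_def
  proof (intro nn_integral_mono)
    fix t
    show "ennreal (h t powr p t / t) * indicator A t
      \<le> ennreal (exp (3 * c)) * (ennreal (h t powr p' t / t) * indicator A t)
        + ennreal (x t / t) * indicator A t"
    proof (cases "t \<in> A")
      case True
      with A have t: "0 < t" by auto
      have "h t powr p t / t \<le> (exp (3 * c) * h t powr p' t + x t) / t"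
        using True t c by (intro divide_right_mono powr_le_powr_exponent_change h p x pp') auto
      also have "\<dots> = exp (3 * c) * (h t powr p' t / t) + x t / t"
        by (simp add: add_divide_distrib)
      finally show ?thesis
        using True t x(1)[OF True]
        by (simp add: ennreal_leI flip: ennreal_mult ennreal_plus)
    qed simp
  qed
  also have "\<dots> = ennreal (exp (3 * c)) * modular A p' h + (\<integral>\<^sup>+t\<in>A. ennreal (x t / t) \<partial>lebesgue)"
    unfolding modular_def by (simp add: nn_integral_add nn_integral_cmult)
  also have "\<dots> \<le> ennreal (exp (3 * c)) * modular A p' h + 1"
    using int by (intro add_left_mono)
  finally show ?thesis .
qed

text \<open>With \<open>x t = t\<close> the integral of \<open>x\<close> against dt/t is the length
  of the interval. The hypotheses on \<open>p\<close> and \<open>p'\<close> are symmetric, so the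
  lemma serves for passing from \<open>q\<close> to the constant exponent and back.\<close>

lemma modular_exponent_change_unit_interval:
  assumes h: "doubling h" and [measurable]: "h \<in> borel_measurable lebesgue"
      "p \<in> borel_measurable lebesgue" "p' \<in> borel_measurable lebesgue"
    and p: "\<And>t. 1 \<le> p t" "\<And>t. 1 \<le> p' t" and "0 \<le> c"
    and pp': "\<And>t. \<bar>p t - p' t\<bar> \<le> c / ln (exp 1 + 1 / \<bar>t\<bar>)"
    and le: "modular {0<..<1} p' h \<le> 1"
  shows "modular {0<..<1} p h \<le> ennreal (exp (3 * c) + 1)"
proof -
  have "h t \<le> 8" if "t \<in> {0<..<1}" for t
    using that by (intro doubling_le_8[OF h _ that _ p(2) le]) auto
  moreover have "(\<integral>\<^sup>+t\<in>{0<..<1}. ennreal (t / t) \<partial>lebesgue) \<le> (1::ennreal)"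
  proof -
    have "(\<integral>\<^sup>+t\<in>{0<..<1}. ennreal (t / t) \<partial>lebesgue) = (\<integral>\<^sup>+t. indicator {0<..<1::real} t \<partial>lebesgue)"
      by (intro nn_integral_cong) (auto simp: indicator_def)
    then show ?thesis by simp
  qed
  moreover have "\<bar>p t - p' t\<bar> \<le> c / ln (exp 1 + 1 / t)" if "t \<in> {0<..<1}" for t
    using pp'[of t] that by simp
  ultimately have "modular {0<..<1} p h \<le> ennreal (exp (3 * c)) * modular {0<..<1} p' h + 1"
    using \<open>0 \<le> c\<close>
    by (intro modular_exponent_change[where x = "\<lambda>t. t"])
      (auto intro: doubling_nonneg[OF h] p)
  also have "\<dots> \<le> ennreal (exp (3 * c)) * 1 + 1"
    using le by (intro add_right_mono mult_left_mono) auto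
  finally show ?thesis by simp
qed

text \<open>The choice \<open>x t = 1 / t\<close> gives the decay condition at infinity the form of
  the one at the origin, and the integral of \<open>1 / t\<^sup>2\<close> over \<open>{1<..}\<close>
  is 1.\<close>

lemma modular_exponent_change_unbounded_interval:
  assumes h: "doubling h" and [measurable]: "h \<in> borel_measurable lebesgue"
      "p \<in> borel_measurable lebesgue" "p' \<in> borel_measurable lebesgue"
    and p: "\<And>t. 1 \<le> p t" "\<And>t. 1 \<le> p' t" and "0 \<le> c"
    and pp': "\<And>t. \<bar>p t - p' t\<bar> \<le> c / ln (exp 1 + \<bar>t\<bar>)"
    and le: "modular {1<..} p' h \<le> 1"
  shows "modular {1<..} p h \<le> ennreal (exp (3 * c) + 1)"
proof -
  have "h t \<le> 8" if "t \<in> {1<..}" for t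
    using that by (intro doubling_le_8[OF h _ that _ p(2) le]) auto
  moreover have "(\<integral>\<^sup>+t\<in>{1<..}. ennreal (1 / t / t) \<partial>lebesgue) \<le> (1::ennreal)"
  proof -
    have "(\<integral>\<^sup>+t\<in>{1<..}. ennreal (1 / t / t) \<partial>lebesgue)
        \<le> (\<integral>\<^sup>+t. ennreal (1 / t / t) * indicator {1..} t \<partial>lborel)"
      \<comment> \<open>Passing to \<open>lborel\<close> and closing the half-line at 1 prepares for
        the fundamental theorem in the next step.\<close>
      by (subst nn_integral_completion, intro nn_integral_mono) (auto simp: indicator_def)
    also have "\<dots> = ennreal (0 - (- 1 / 1))"
    proof (rule nn_integral_FTC_atLeast[where F = "\<lambda>t. - 1 / t"])
      show "((\<lambda>t::real. - 1 / t) \<longlongrightarrow> 0) at_top"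
        by (intro tendsto_divide_0[OF tendsto_const] filterlim_at_top_imp_at_infinity filterlim_ident)
      show "((\<lambda>t. - 1 / t) has_real_derivative 1 / t / t) (at t)" if "1 \<le> t" for t
        using that by (auto intro!: derivative_eq_intros simp: divide_simps)
    qed auto
    finally show ?thesis by simp
  qed
  moreover have "\<bar>p t - p' t\<bar> \<le> c / ln (exp 1 + 1 / (1 / t))" if "t \<in> {1<..}" for t
    using pp'[of t] that by simp
  ultimately have "modular {1<..} p h \<le> ennreal (exp (3 * c)) * modular {1<..} p' h + 1"
    using \<open>0 \<le> c\<close>
    by (intro modular_exponent_change[where x = "\<lambda>t. 1 / t"])
      (auto intro: doubling_nonneg[OF h] p)
  also have "\<dots> \<le> ennreal (exp (3 * c)) * 1 + 1"
    using le by (intro add_right_mono mult_left_mono) auto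
  finally show ?thesis by simp
qed

section \<open>The Luxemburg norm against two constant exponents\<close>

lemma modular_split_at_1:
  assumes [measurable]: "p \<in> borel_measurable lebesgue" "h \<in> borel_measurable lebesgue"
  shows "modular {0<..} p h = modular {0<..<1} p h + modular {1<..} p h"
proof -
  have "AE t in lebesgue. t \<noteq> (1::real)"
    by (intro AE_I'[of "{1}"]) auto
  then have "modular {0<..} p h = (\<integral>\<^sup>+t. ennreal (h t powr p t / t) * indicator {0<..<1} t
      + ennreal (h t powr p t / t) * indicator {1<..} t \<partial>lebesgue)"
    unfolding modular_def
    by (intro nn_integral_cong_AE) (auto elim!: eventually_mono simp: indicator_def)
  also have "\<dots> = modular {0<..<1} p h + modular {1<..} p h"
    unfolding modular_def by (intro nn_integral_add) measurable
  finally show ?thesis .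
qed

text \<open>Used to replace the function inside \<open>interp_norm\<close> by one that vanishes for
  \<open>t \<le> 0\<close>.\<close>

lemma Luxemburg_norm_cong:
  assumes "\<And>t. 0 < t \<Longrightarrow> g t = g' t"
  shows "Luxemburg_norm q g = Luxemburg_norm q g'"
proof -
  have "(\<integral>\<^sup>+t\<in>{0<..}. ennreal (\<bar>g t / r\<bar> powr q t / t) \<partial>lebesgue)
      = (\<integral>\<^sup>+t\<in>{0<..}. ennreal (\<bar>g' t / r\<bar> powr q t / t) \<partial>lebesgue)" for r
    using assms by (intro nn_integral_cong) (auto simp: indicator_def)
  then show ?thesis by (simp add: Luxemburg_norm_def)
qed

lemma Luxemburg_norm_eq_modular:
  assumes "\<And>t. 0 < t \<Longrightarrow> 0 \<le> g t"
  shows "Luxemburg_norm q g = Inf {ennreal r | r. 0 < r \<and> modular {0<..} q (\<lambda>t. g t / r) \<le> 1}"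
proof -
  have "(\<integral>\<^sup>+t\<in>{0<..}. ennreal (\<bar>g t / r\<bar> powr q t / t) \<partial>lebesgue) = modular {0<..} q (\<lambda>t. g t / r)"
    if "0 < r" for r
    unfolding modular_def
    by (intro nn_integral_cong) (use that assms in \<open>auto simp: indicator_def\<close>)
  then show ?thesis
    unfolding Luxemburg_norm_def by (intro arg_cong[where f = Inf]) auto
qed

text \<open>For the weighted \<open>K\<close>-functional this is the integral expression of the
  second equivalence.\<close>

definition split_norm :: "real \<Rightarrow> real \<Rightarrow> (real \<Rightarrow> real) \<Rightarrow> ennreal" where
  "split_norm p0 p1 h = ennreal_powr (modular {0<..<1} (\<lambda>_. p0) h) (1 / p0)
     + ennreal_powr (modular {1<..} (\<lambda>_. p1) h) (1 / p1)"

context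
  fixes g q :: "real \<Rightarrow> real" and q0 q1 c :: real
  assumes g: "doubling g" and g_meas [measurable]: "g \<in> borel_measurable lebesgue"
    and q_meas [measurable]: "q \<in> borel_measurable lebesgue"
    and q: "\<And>t. 1 \<le> q t" and q0: "1 \<le> q0" and q1: "1 \<le> q1" and c: "0 \<le> c"
    and origin: "\<And>t. \<bar>q t - q0\<bar> \<le> c / ln (exp 1 + 1 / \<bar>t\<bar>)"
    and infinity: "\<And>t. \<bar>q t - q1\<bar> \<le> c / ln (exp 1 + \<bar>t\<bar>)"
begin

private lemma g_nonneg: "0 < t \<Longrightarrow> 0 \<le> g t"
  by (rule doubling_nonneg[OF g])

private lemmas Luxemburg_norm_g = Luxemburg_norm_eq_modular[of g q, OF g_nonneg, simplified]

text \<open>If \<open>r\<close> is admissible in the infimum, the exponent change bounds both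
  constant-exponent modulars of \<open>g / r\<close> by \<open>D\<close>, so each summand of
  \<open>split_norm\<close> is at most \<open>r * D\<close>. The factor 2 counts the
  summands.\<close>

lemma split_norm_le_Luxemburg_norm:
  "ennreal (1 / (2 * (exp (3 * c) + 1))) * split_norm q0 q1 g \<le> Luxemburg_norm q g"
proof -
  define D where "D = exp (3 * c) + 1"
  have D: "1 \<le> D" by (simp add: D_def)
  have "ennreal (1 / (2 * D)) * split_norm q0 q1 g \<le> ennreal r"
    if r: "0 < r" and le: "modular {0<..} q (\<lambda>t. g t / r) \<le> 1" for r
  proof -
    define h where "h = (\<lambda>t. g t / r)"
    have h: "doubling h" unfolding h_def by (rule doubling_divide[OF g r])
    have [measurable]: "h \<in> borel_measurable lebesgue" unfolding h_def by measurable
    have "modular A q h \<le> 1" if "A \<subseteq> {0<..}" for A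
      using modular_mono_set[OF that, of q h] le unfolding h_def by (rule order_trans)
    then have "modular {0<..<1} q h \<le> 1" "modular {1<..} q h \<le> 1"
      by (simp_all add: subset_iff)
    \<comment> \<open>Here \<open>q\<close> takes the place of \<open>p'\<close>, because its
      modular is the one known to be at most 1.\<close>
    then have "modular {0<..<1} (\<lambda>_. q0) h \<le> ennreal D" "modular {1<..} (\<lambda>_. q1) h \<le> ennreal D"
      unfolding D_def using q q0 q1 c origin infinity
      by (intro modular_exponent_change_unit_interval[OF h, where p' = q]
          modular_exponent_change_unbounded_interval[OF h, where p' = q];
          simp add: abs_minus_commute)+
    then have "modular {0<..<1} (\<lambda>_. q0) (\<lambda>t. h t / D) \<le> 1"
        "modular {1<..} (\<lambda>_. q1) (\<lambda>t. h t / D) \<le> 1"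
      using D q0 q1 by (auto intro!: modular_divide_le doubling_nonneg[OF h])
    then have "modular {0<..<1} (\<lambda>_. q0) (\<lambda>t. g t / (r * D)) \<le> 1"
        "modular {1<..} (\<lambda>_. q1) (\<lambda>t. g t / (r * D)) \<le> 1"
      by (simp_all add: h_def)
    then have "ennreal_powr (modular {0<..<1} (\<lambda>_. q0) g) (1 / q0) \<le> ennreal (r * D)"
        "ennreal_powr (modular {1<..} (\<lambda>_. q1) g) (1 / q1) \<le> ennreal (r * D)"
      using r D q0 q1
      by (intro iffD2[OF ennreal_powr_modular_le_iff]; simp add: g_nonneg subset_iff)+
    then have "split_norm q0 q1 g \<le> ennreal (r * D) + ennreal (r * D)"
      unfolding split_norm_def by (rule add_mono)
    also have "\<dots> = ennreal (2 * D * r)"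
      using r D by (simp add: algebra_simps flip: ennreal_plus)
    finally have "ennreal (1 / (2 * D)) * split_norm q0 q1 g \<le> ennreal (1 / (2 * D)) * ennreal (2 * D * r)"
      by (rule mult_left_mono) simp
    also have "\<dots> = ennreal r"
      using r D by (simp flip: ennreal_mult)
    finally show ?thesis .
  qed
  then show ?thesis
    unfolding Luxemburg_norm_g D_def
    by (intro Inf_greatest) auto
qed

text \<open>For any positive \<open>r\<close> above \<open>split_norm\<close> each part of the
  \<open>q\<close>-modular of \<open>g / r\<close> is at most \<open>D / 2\<close>, their sum at
  most \<open>D\<close>, so \<open>r * D\<close> is admissible in the infimum.\<close>

lemma Luxemburg_norm_le_split_norm:
  "Luxemburg_norm q g \<le> ennreal (2 * (exp (3 * c) + 1)) * split_norm q0 q1 g"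
proof -
  define D where "D = 2 * (exp (3 * c) + 1)"
  have D: "1 \<le> D" by (simp add: D_def add_increasing)
  have half: "D / 2 = exp (3 * c) + 1" by (simp add: D_def)
  have le: "Luxemburg_norm q g \<le> ennreal (r * D)"
    if r: "0 < r" and le: "split_norm q0 q1 g \<le> ennreal r" for r
  proof -
    define h where "h = (\<lambda>t. g t / r)"
    have h: "doubling h" unfolding h_def by (rule doubling_divide[OF g r])
    have [measurable]: "h \<in> borel_measurable lebesgue" unfolding h_def by measurable
    have "ennreal_powr (modular {0<..<1} (\<lambda>_. q0) g) (1 / q0) \<le> ennreal r"
        "ennreal_powr (modular {1<..} (\<lambda>_. q1) g) (1 / q1) \<le> ennreal r"
      by (auto intro: order_trans[OF _ le[unfolded split_norm_def]])
    then have "modular {0<..<1} (\<lambda>_. q0) h \<le> 1" "modular {1<..} (\<lambda>_. q1) h \<le> 1"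
      unfolding h_def using r q0 q1
      by (intro iffD1[OF ennreal_powr_modular_le_iff]; simp add: g_nonneg subset_iff)+
    then have "modular {0<..<1} q h \<le> ennreal (D / 2)" "modular {1<..} q h \<le> ennreal (D / 2)"
      unfolding half using q q0 q1 c origin infinity
      by (intro modular_exponent_change_unit_interval[OF h, where p' = "\<lambda>_. q0"]
          modular_exponent_change_unbounded_interval[OF h, where p' = "\<lambda>_. q1"]; simp)+
    then have "modular {0<..} q h \<le> ennreal (D / 2) + ennreal (D / 2)"
      by (subst modular_split_at_1) (auto intro: add_mono)
    also have "\<dots> = ennreal D"
      using D by (simp flip: ennreal_plus)
    finally have "modular {0<..} q (\<lambda>t. h t / D) \<le> 1"
      using D q by (intro modular_divide_le) (auto intro: doubling_nonneg[OF h])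
    then show ?thesis
      unfolding Luxemburg_norm_g using r D
      by (intro Inf_lower) (auto simp: h_def intro!: exI[of _ "r * D"])
  qed
  show ?thesis
  proof (cases "split_norm q0 q1 g")
    case top
    then show ?thesis
      unfolding D_def[symmetric] using D by (simp add: ennreal_mult_top)
  next
    case (real i)
    have "Luxemburg_norm q g \<le> ennreal (D * i)"
    \<comment> \<open>The value \<open>i\<close> may be 0 while \<open>r\<close> has to be positive,
      so \<open>i\<close> is approached from above; \<open>e / D\<close> becomes \<open>e\<close>
      after multiplication by \<open>D\<close>.\<close>
    proof (rule ennreal_le_epsilon)
      fix e :: real assume "0 < e"
      then have "Luxemburg_norm q g \<le> ennreal ((i + e / D) * D)"
        using real D by (intro le) (auto simp: ennreal_leI add_nonneg_pos)
      also have "(i + e / D) * D = D * i + e" using D by (simp add: field_simps)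
      finally show "Luxemburg_norm q g \<le> ennreal (D * i) + ennreal e"
        using real D \<open>0 < e\<close> by simp
    qed
    then show ?thesis
      unfolding D_def[symmetric] using real D by (simp add: ennreal_mult)
  qed
qed

end

text \<open>\<open>q_inf\<close> is the limit of \<open>q\<close> at infinity and inherits its lower
  bound; the theorem does not assume this bound.\<close>

lemma log_Hoelder_at_infinity_limit_ge_1:
  assumes "\<And>x. 1 \<le> q x" "log_Hoelder_at_infinity q q_inf"
  shows "1 \<le> q_inf"
proof (rule ccontr)
  assume *: "\<not> 1 \<le> q_inf"
  from assms obtain c where c: "0 < c" "\<And>x. \<bar>q x - q_inf\<bar> \<le> c / ln (exp 1 + \<bar>x\<bar>)"
    by (auto simp: log_Hoelder_at_infinity_def)
  \<comment> \<open>Chosen so that \<open>ln x\<close> is exactly the size at which the error bound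
    equals \<open>1 - q_inf\<close>; the summand \<open>exp 1\<close> makes the inequality
    strict.\<close>
  define x where "x = exp (c / (1 - q_inf))"
  have "ln x < ln (exp 1 + \<bar>x\<bar>)"
    by (subst ln_less_cancel_iff) (auto simp: x_def intro: add_pos_pos)
  then have "c / (1 - q_inf) < ln (exp 1 + \<bar>x\<bar>)" by (simp add: x_def)
  then have "c / ln (exp 1 + \<bar>x\<bar>) < 1 - q_inf"
    using * c by (smt (verit) divide_less_eq divide_pos_pos mult.commute)
  with c(2)[of x] assms(1)[of x] show False by linarith
qed

section \<open>Dyadic blocks and dyadic sums\<close>

text \<open>On the block, \<open>h\<close> agrees with \<open>h a\<close> up to the factor 2, and
  \<open>1 / s\<close> lies between \<open>1 / a\<close> and \<open>2 / a\<close>, while the length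
  is \<open>a / 2\<close>. The losses \<open>2 powr p\<close> and \<open>2 * 2 powr p\<close> are
  rounded up to \<open>4 powr p\<close>, whose p-th root is independent of \<open>p\<close>.\<close>

lemma modular_dyadic_block:
  assumes h: "doubling h" and [measurable]: "h \<in> borel_measurable lebesgue"
    and "1 \<le> p" "0 < a"
  shows modular_dyadic_block_le: "modular {a / 2<..a} (\<lambda>_. p) h \<le> ennreal (4 powr p) * ennreal (h a powr p)"
    and modular_dyadic_block_ge: "ennreal (h a powr p) \<le> ennreal (4 powr p) * modular {a / 2<..a} (\<lambda>_. p) h"
proof -
  have h0: "0 \<le> h s" if "0 < s" for s using doubling_nonneg[OF h that] .
  have hs: "h s \<le> 2 * h a" "h a \<le> 2 * h s" if "s \<in> {a / 2<..a}" for s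
    using that \<open>0 < a\<close> by (auto intro!: doubling_le[OF h])
  have four: "4 powr p = 2 powr p * 2 powr p" by (simp flip: powr_mult)
  have two: "2 \<le> 2 powr p" using powr_mono[of 1 p 2] \<open>1 \<le> p\<close> by simp
  have "modular {a / 2<..a} (\<lambda>_. p) h
      \<le> (\<integral>\<^sup>+s. ennreal (2 powr p * h a powr p * (2 / a)) * indicator {a / 2<..a} s \<partial>lebesgue)"
    unfolding modular_def
  proof (intro nn_integral_mono, goal_cases)
    case (1 s)
    show ?case
    proof (cases "s \<in> {a / 2<..a}")
      case True
      with \<open>0 < a\<close> have s: "0 < s" by auto
      have "h s powr p \<le> (2 * h a) powr p"
        using hs[OF True] h0[OF s] \<open>1 \<le> p\<close> by (intro powr_mono2) auto
      moreover have "1 / s \<le> 2 / a" using True \<open>0 < a\<close> s by (auto simp: divide_simps)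
      ultimately have "h s powr p * (1 / s) \<le> (2 * h a) powr p * (2 / a)"
        using s by (intro mult_mono) auto
      then show ?thesis using True h0[OF \<open>0 < a\<close>] by (simp add: powr_mult ennreal_leI)
    qed simp
  qed
  also have "\<dots> = ennreal (2 powr p * h a powr p)"
    using \<open>0 < a\<close> by (subst nn_integral_cmult_indicator) (auto simp flip: ennreal_mult)
  also have "\<dots> \<le> ennreal (4 powr p) * ennreal (h a powr p)"
    unfolding four using two mult_right_mono[of 1 "2 powr p" "2 powr p * h a powr p"]
    by (simp add: mult.assoc ennreal_leI flip: ennreal_mult)
  finally show "modular {a / 2<..a} (\<lambda>_. p) h \<le> ennreal (4 powr p) * ennreal (h a powr p)" .
  have "ennreal (h a powr p) = ennreal (2 * h a powr p / a) * ennreal (a / 2)"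
    using \<open>0 < a\<close> by (simp flip: ennreal_mult)
  also have "\<dots> = (\<integral>\<^sup>+s. ennreal (2 * h a powr p / a) * indicator {a / 2<..a} s \<partial>lebesgue)"
    using \<open>0 < a\<close> by (subst nn_integral_cmult_indicator) auto
  also have "\<dots> \<le> (\<integral>\<^sup>+s. ennreal (4 powr p) * (ennreal (h s powr p / s) * indicator {a / 2<..a} s) \<partial>lebesgue)"
  proof (intro nn_integral_mono, goal_cases)
    case (1 s)
    show ?case
    proof (cases "s \<in> {a / 2<..a}")
      case True
      with \<open>0 < a\<close> have s: "0 < s" by auto
      have "h a powr p \<le> (2 * h s) powr p"
        using hs[OF True] h0[OF \<open>0 < a\<close>] \<open>1 \<le> p\<close> by (intro powr_mono2) auto
      then have "h a powr p \<le> 2 powr p * h s powr p"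
        using h0[OF s] by (simp add: powr_mult)
      then have "2 * h a powr p \<le> 2 powr p * (2 powr p * h s powr p)"
        using two by (intro mult_mono) auto
      then have "2 * h a powr p / a \<le> 2 powr p * (2 powr p * h s powr p) / s"
        using True s by (intro frac_le) auto
      then show ?thesis using True s by (simp add: four mult.assoc ennreal_leI flip: ennreal_mult)
    qed simp
  qed
  also have "\<dots> = ennreal (4 powr p) * modular {a / 2<..a} (\<lambda>_. p) h"
    unfolding modular_def by (intro nn_integral_cmult) measurable
  finally show "ennreal (h a powr p) \<le> ennreal (4 powr p) * modular {a / 2<..a} (\<lambda>_. p) h" .
qed

text \<open>Blocks closed on the right match the ceiling. The unique index gives disjointness as
  well as covering.\<close>

lemma dyadic_block_iff:
  assumes "0 < t"
  shows "t \<in> {2 powr real_of_int v / 2<..2 powr real_of_int v} \<longleftrightarrow> v = \<lceil>log 2 t\<rceil>"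
proof -
  have "2 powr real_of_int v / 2 = 2 powr (real_of_int v - 1)" by (simp add: powr_diff)
  then have "t \<in> {2 powr real_of_int v / 2<..2 powr real_of_int v}
      \<longleftrightarrow> real_of_int v - 1 < log 2 t \<and> log 2 t \<le> real_of_int v"
    using assms by (simp add: less_log_iff log_le_iff)
  also have "\<dots> \<longleftrightarrow> v = \<lceil>log 2 t\<rceil>" by linarith
  finally show ?thesis .
qed

text \<open>As a function of the set, the modular is the measure with density
  \<open>h t powr p t / t\<close>, hence countably additive on the disjoint blocks.\<close>

lemma modular_UN_dyadic_blocks:
  assumes [measurable]: "h \<in> borel_measurable lebesgue" "p \<in> borel_measurable lebesgue"
  shows "modular (\<Union>v\<in>V. {2 powr real_of_int v / 2<..2 powr real_of_int v}) p h
      = (\<integral>\<^sup>+v. modular {2 powr real_of_int v / 2<..2 powr real_of_int v} p h \<partial>count_space V)"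
proof -
  let ?M = "density lebesgue (\<lambda>t. ennreal (h t powr p t / t))"
  let ?B = "\<lambda>v::int. {2 powr real_of_int v / 2<..2 powr real_of_int v}"
  have B: "emeasure ?M A = modular A p h" if "A \<in> sets lebesgue" for A
    unfolding modular_def using that by (intro emeasure_density) measurable
  have "u = v" if "t \<in> ?B u" "t \<in> ?B v" for t u v
  proof -
    have "0 < 2 powr real_of_int u / 2" by simp
    also have "\<dots> < t" using that by simp
    finally have "0 < t" .
    then show ?thesis using that unfolding dyadic_block_iff[OF \<open>0 < t\<close>] by simp
  qed
  then have "disjoint_family_on ?B V" unfolding disjoint_family_on_def by blast
  then have "emeasure ?M (\<Union> (?B ` V)) = (\<integral>\<^sup>+v. emeasure ?M (?B v) \<partial>count_space V)"
    by (intro emeasure_UN_countable) auto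
  then show ?thesis by (simp add: B sets.countable_UN')
qed

text \<open>Block \<open>v\<close> ends at \<open>2 powr v\<close>, so the block of index 0 ends at
  1: the sums split where the integrals do, up to the null set \<open>{1}\<close>.\<close>

lemma UN_dyadic_blocks_nonpos:
  "(\<Union>v\<in>{..0}. {2 powr real_of_int v / 2<..2 powr real_of_int v}) = {0<..1}" (is "?U = _")
proof (intro set_eqI iffI)
  fix t assume "t \<in> ?U"
  then obtain v :: int where v: "v \<le> 0" "2 powr real_of_int v / 2 < t" "t \<le> 2 powr real_of_int v" by auto
  have "2 powr real_of_int v \<le> 2 powr 0" using v(1) by (intro powr_mono) auto
  moreover have "0 < 2 powr real_of_int v / 2" by simp
  ultimately show "t \<in> {0<..1}" using v by (simp del: zero_less_divide_iff)
next
  fix t :: real assume t: "t \<in> {0<..1}"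
  then have "t \<in> {2 powr real_of_int \<lceil>log 2 t\<rceil> / 2<..2 powr real_of_int \<lceil>log 2 t\<rceil>}"
    by (subst dyadic_block_iff) auto
  moreover have "\<lceil>log 2 t\<rceil> \<le> 0" using t by (simp add: ceiling_le_zero)
  ultimately show "t \<in> ?U" by blast
qed

lemma UN_dyadic_blocks_pos:
  "(\<Union>v\<in>{1..}. {2 powr real_of_int v / 2<..2 powr real_of_int v}) = {1<..}" (is "?U = _")
proof (intro set_eqI iffI)
  fix t assume "t \<in> ?U"
  then obtain v :: int where v: "1 \<le> v" "2 powr real_of_int v / 2 < t" "t \<le> 2 powr real_of_int v" by auto
  have "2 powr 1 \<le> 2 powr real_of_int v" using v(1) by (intro powr_mono) auto
  then show "t \<in> {1<..}" using v by simp
next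
  fix t :: real assume t: "t \<in> {1<..}"
  then have "t \<in> {2 powr real_of_int \<lceil>log 2 t\<rceil> / 2<..2 powr real_of_int \<lceil>log 2 t\<rceil>}"
    by (subst dyadic_block_iff) auto
  moreover have "0 < log 2 t" using t by simp
  then have "1 \<le> \<lceil>log 2 t\<rceil>" by linarith
  ultimately show "t \<in> ?U" by (meson UN_I atLeast_iff)
qed

text \<open>Summing the block estimates keeps the factor \<open>4 powr p\<close>, and the p-th root
  turns it into 4.\<close>

lemma dyadic_sum_modular:
  assumes h: "doubling h" and [measurable]: "h \<in> borel_measurable lebesgue" and "1 \<le> p"
  defines "A \<equiv> \<lambda>V. \<Union>v\<in>V. {2 powr real_of_int v / 2<..2 powr real_of_int v}"
    and "\<Sigma> \<equiv> \<lambda>V. \<Sum>\<^sub>\<infinity>v\<in>V. ennreal (h (2 powr real_of_int v) powr p)"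
  shows modular_le_dyadic_sum:
      "ennreal_powr (modular (A V) (\<lambda>_. p) h) (1 / p) \<le> ennreal 4 * ennreal_powr (\<Sigma> V) (1 / p)"
    and dyadic_sum_le_modular:
      "ennreal_powr (\<Sigma> V) (1 / p) \<le> ennreal 4 * ennreal_powr (modular (A V) (\<lambda>_. p) h) (1 / p)"
proof -
  have S: "\<Sigma> V = (\<integral>\<^sup>+v. ennreal (h (2 powr real_of_int v) powr p) \<partial>count_space V)"
    unfolding \<Sigma>_def by (intro infsum_ennreal_eq_nn_integral_count_space) simp
  have M: "modular (A V) (\<lambda>_. p) h
      = (\<integral>\<^sup>+v. modular {2 powr real_of_int v / 2<..2 powr real_of_int v} (\<lambda>_. p) h \<partial>count_space V)"
    unfolding A_def by (intro modular_UN_dyadic_blocks) measurable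
  have "modular (A V) (\<lambda>_. p) h \<le> ennreal (4 powr p) * \<Sigma> V"
    unfolding S M using \<open>1 \<le> p\<close>
    by (subst nn_integral_cmult[symmetric]) (auto intro!: nn_integral_mono modular_dyadic_block_le[OF h])
  then show "ennreal_powr (modular (A V) (\<lambda>_. p) h) (1 / p) \<le> ennreal 4 * ennreal_powr (\<Sigma> V) (1 / p)"
    using \<open>1 \<le> p\<close> by (intro ennreal_powr_inverse_cmult_le) auto
  have "\<Sigma> V \<le> ennreal (4 powr p) * modular (A V) (\<lambda>_. p) h"
    unfolding S M using \<open>1 \<le> p\<close>
    by (subst nn_integral_cmult[symmetric]) (auto intro!: nn_integral_mono modular_dyadic_block_ge[OF h])
  then show "ennreal_powr (\<Sigma> V) (1 / p) \<le> ennreal 4 * ennreal_powr (modular (A V) (\<lambda>_. p) h) (1 / p)"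
    using \<open>1 \<le> p\<close> by (intro ennreal_powr_inverse_cmult_le) auto
qed

lemma modular_unit_interval_closed: "modular {0<..1} p h = modular {0<..<1} p h"
proof -
  have "AE t in lebesgue. t \<noteq> (1::real)"
    by (intro AE_I'[of "{1}"]) auto
  then show ?thesis
    unfolding modular_def
    by (intro nn_integral_cong_AE) (auto elim!: eventually_mono simp: indicator_def)
qed

text \<open>The expression of the first equivalence, with the powers of 2 absorbed into
  \<open>h\<close>.\<close>

definition dyadic_norm :: "real \<Rightarrow> real \<Rightarrow> (real \<Rightarrow> real) \<Rightarrow> ennreal" where
  "dyadic_norm p0 p1 h =
     ennreal_powr (\<Sum>\<^sub>\<infinity>v\<in>{..0::int}. ennreal (h (2 powr real_of_int v) powr p0)) (1 / p0)
   + ennreal_powr (\<Sum>\<^sub>\<infinity>v\<in>{1::int..}. ennreal (h (2 powr real_of_int v) powr p1)) (1 / p1)"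

lemma
  assumes "doubling h" "h \<in> borel_measurable lebesgue" "1 \<le> p0" "1 \<le> p1"
  shows split_norm_le_dyadic_norm: "split_norm p0 p1 h \<le> ennreal 4 * dyadic_norm p0 p1 h"
    and dyadic_norm_le_split_norm: "dyadic_norm p0 p1 h \<le> ennreal 4 * split_norm p0 p1 h"
  using modular_le_dyadic_sum[OF assms(1,2,3), of "{..0}"] dyadic_sum_le_modular[OF assms(1,2,3), of "{..0}"]
    modular_le_dyadic_sum[OF assms(1,2,4), of "{1..}"] dyadic_sum_le_modular[OF assms(1,2,4), of "{1..}"]
  unfolding split_norm_def dyadic_norm_def UN_dyadic_blocks_nonpos UN_dyadic_blocks_pos
    modular_unit_interval_closed
  by (simp_all only: distrib_left add_mono)

section \<open>The \<open>K\<close>-functional and its weighted form\<close>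

lemma K_functional_nonneg:
  assumes "f \<in> couple_sum j0 j1" "0 < t"
  shows "0 \<le> K_functional j0 j1 t f"
  unfolding K_functional_def using assms by (intro cInf_greatest) (auto simp: couple_sum_def)

text \<open>Both bounds insert a decomposition for one parameter into the infimum for the other and
  compare the two summands separately.\<close>

lemma K_functional_quasiconcave:
  assumes "f \<in> couple_sum j0 j1" and "0 < s" "s \<le> t"
  shows K_functional_mono: "K_functional j0 j1 s f \<le> K_functional j0 j1 t f"
    and K_functional_le_quotient: "K_functional j0 j1 t f \<le> t / s * K_functional j0 j1 s f"
proof -
  let ?S = "\<lambda>t. {norm f0 + t * norm f1 | f0 f1. f = j0 f0 + j1 f1}"
  \<comment> \<open>Membership in the sum space makes the set of values nonempty, and
    \<open>0 < t\<close> bounds it below; the real \<open>Inf\<close> is meaningful only with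
    both.\<close>
  from assms have ne: "?S t \<noteq> {}" for t by (auto simp: couple_sum_def)
  have bdd: "bdd_below (?S t)" if "0 < t" for t
    using that by (intro bdd_belowI[of _ 0]) auto
  have lower: "K_functional j0 j1 t f \<le> norm f0 + t * norm f1"
    if "0 < t" "f = j0 f0 + j1 f1" for t f0 f1
    unfolding K_functional_def using that by (intro cInf_lower bdd) auto
  show "K_functional j0 j1 s f \<le> K_functional j0 j1 t f"
  proof -
    have "K_functional j0 j1 s f \<le> x" if "x \<in> ?S t" for x
    proof -
      from that obtain f0 f1 where x: "x = norm f0 + t * norm f1" "f = j0 f0 + j1 f1" by auto
      have "K_functional j0 j1 s f \<le> norm f0 + s * norm f1" using assms x by (intro lower) auto
      also have "\<dots> \<le> x" using assms x by (simp add: mult_right_mono)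
      finally show ?thesis .
    qed
    then show ?thesis unfolding K_functional_def[of j0 j1 t] by (intro cInf_greatest ne)
  qed
  have "s / t * K_functional j0 j1 t f \<le> x" if "x \<in> ?S s" for x
  proof -
    from that obtain f0 f1 where x: "x = norm f0 + s * norm f1" "f = j0 f0 + j1 f1" by auto
    have "s / t * K_functional j0 j1 t f \<le> s / t * (norm f0 + t * norm f1)"
      using assms x by (intro mult_left_mono lower) auto
    also have "\<dots> = s / t * norm f0 + s * norm f1" using assms by (simp add: distrib_left)
    also have "\<dots> \<le> x" using assms x mult_right_mono[of "s / t" 1 "norm f0"] by simp
    finally show ?thesis .
  qed
  then have "s / t * K_functional j0 j1 t f \<le> K_functional j0 j1 s f"
    unfolding K_functional_def[of j0 j1 s] by (intro cInf_greatest ne)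
  then show "K_functional j0 j1 t f \<le> t / s * K_functional j0 j1 s f"
    using assms by (simp add: field_simps)
qed

text \<open>The cut-off at \<open>0\<close> replaces the junk values of the \<open>K\<close>-functional at \<open>t \<le> 0\<close>.\<close>

definition weighted_K ::
    "('a::banach \<Rightarrow> 'z::hausdorff_tvs) \<Rightarrow> ('b::banach \<Rightarrow> 'z) \<Rightarrow> real \<Rightarrow> 'z \<Rightarrow> real \<Rightarrow> real" where
  "weighted_K j0 j1 \<theta> f t = (if 0 < t then t powr (-\<theta>) * K_functional j0 j1 t f else 0)"

text \<open>Measurability comes from monotonicity: the \<open>K\<close>-functional increases on the
  positive half-line and is nonnegative there, so its extension by 0 is monotone on the whole
  line.\<close>

lemma weighted_K_measurable:
  assumes "f \<in> couple_sum j0 j1"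
  shows "weighted_K j0 j1 \<theta> f \<in> borel_measurable lebesgue"
proof -
  have "mono (\<lambda>t. if 0 < t then K_functional j0 j1 t f else 0)"
    using K_functional_nonneg[OF assms] K_functional_mono[OF assms] by (intro monoI) auto
  then have [measurable]: "(\<lambda>t. if 0 < t then K_functional j0 j1 t f else 0) \<in> borel_measurable borel"
    by (rule borel_measurable_mono)
  have "weighted_K j0 j1 \<theta> f = (\<lambda>t. t powr (-\<theta>) * (if 0 < t then K_functional j0 j1 t f else 0))"
    by (auto simp: weighted_K_def)
  also have "\<dots> \<in> borel_measurable borel" by measurable
  finally show ?thesis by (intro measurable_completion) simp
qed

text \<open>The two factors move in opposite directions. For \<open>s \<le> t\<close> the power
  decreases and the \<open>K\<close>-functional grows at most by \<open>t / s \<le> 2\<close>; for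
  \<open>t < s\<close> the \<open>K\<close>-functional decreases and the power grows at most by
  \<open>2 powr \<theta> \<le> 2\<close>.\<close>

lemma doubling_weighted_K:
  assumes f: "f \<in> couple_sum j0 j1" and "0 < \<theta>" "\<theta> < 1"
  shows "doubling (weighted_K j0 j1 \<theta> f)"
  unfolding doubling_def
proof (intro conjI allI impI)
  fix t :: real assume "0 < t"
  then show "0 \<le> weighted_K j0 j1 \<theta> f t"
    using K_functional_nonneg[OF f, of t] by (simp add: weighted_K_def)
next
  fix s t :: real assume st: "0 < s" "0 < t" "t \<le> 2 * s" "s \<le> 2 * t"
  let ?K = "\<lambda>t. K_functional j0 j1 t f"
  have K0: "0 \<le> ?K s" "0 \<le> ?K t" using st K_functional_nonneg[OF f] by blast+
  have "t powr (-\<theta>) * ?K t \<le> 2 * (s powr (-\<theta>) * ?K s)"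
  proof (cases "s \<le> t")
    case True
    have "?K t \<le> t / s * ?K s" using st True by (intro K_functional_le_quotient[OF f])
    also have "\<dots> \<le> 2 * ?K s" using st K0 by (intro mult_right_mono) (auto simp: divide_simps)
    finally have "?K t \<le> 2 * ?K s" .
    moreover have "t powr (-\<theta>) \<le> s powr (-\<theta>)"
      using True st assms by (intro powr_mono2') auto
    ultimately have "t powr (-\<theta>) * ?K t \<le> s powr (-\<theta>) * (2 * ?K s)"
      using K0 by (intro mult_mono) auto
    then show ?thesis by simp
  next
    case False
    have "?K t \<le> ?K s" using False st by (intro K_functional_mono[OF f]) auto
    moreover have "t powr (-\<theta>) \<le> 2 * s powr (-\<theta>)"
    proof -
      have "t powr (-\<theta>) \<le> (s / 2) powr (-\<theta>)" using st assms by (intro powr_mono2') auto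
      also have "\<dots> = 2 powr \<theta> * s powr (-\<theta>)"
        using st by (simp add: powr_divide powr_minus divide_simps)
      also have "\<dots> \<le> 2 powr 1 * s powr (-\<theta>)"
        using assms by (intro mult_right_mono powr_mono) auto
      finally show ?thesis by simp
    qed
    ultimately have "t powr (-\<theta>) * ?K t \<le> (2 * s powr (-\<theta>)) * ?K s"
      using K0 by (intro mult_mono) auto
    then show ?thesis by simp
  qed
  then show "weighted_K j0 j1 \<theta> f t \<le> 2 * weighted_K j0 j1 \<theta> f s"
    using st by (simp add: weighted_K_def)
qed

lemma weighted_K_powr:
  assumes "f \<in> couple_sum j0 j1" "0 < t"
  shows "weighted_K j0 j1 \<theta> f t powr p = t powr (- \<theta> * p) * K_functional j0 j1 t f powr p"
  using assms K_functional_nonneg[OF assms] by (simp add: weighted_K_def powr_mult powr_powr)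

section \<open>The two equivalences for the interpolation norm\<close>

theorem lemma5:
  fixes j0 :: "'a::banach \<Rightarrow> 'z::hausdorff_tvs" and j1 :: "'b::banach \<Rightarrow> 'z"
    and \<theta> :: real and q :: "real \<Rightarrow> real" and q_inf :: real
  assumes "compatible_couple j0 j1"
    and "0 < \<theta>" and "\<theta> < 1"
    and "q \<in> variable_exponents"
    and "log_Hoelder_at_origin q"
    and "log_Hoelder_at_infinity q q_inf"
  shows
    "(\<exists>c>0. \<exists>C>0. \<forall>f\<in>interp_space j0 j1 \<theta> q.
        let \<alpha> = (\<lambda>v::int. K_functional j0 j1 (2 powr real_of_int v) f);
            S = ennreal_powr (\<Sum>\<^sub>\<infinity>v\<in>{..0}.
                  ennreal (2 powr (- real_of_int v * \<theta> * q 0) * \<alpha> v powr q 0)) (1 / q 0)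
              + ennreal_powr (\<Sum>\<^sub>\<infinity>v\<in>{1..}.
                  ennreal (2 powr (- real_of_int v * \<theta> * q_inf) * \<alpha> v powr q_inf)) (1 / q_inf)
        in ennreal c * S \<le> interp_norm j0 j1 \<theta> q f \<and> interp_norm j0 j1 \<theta> q f \<le> ennreal C * S)
   \<and> (\<exists>c>0. \<exists>C>0. \<forall>f\<in>interp_space j0 j1 \<theta> q.
        let I = ennreal_powr (\<integral>\<^sup>+t\<in>{0<..<1}.
                  ennreal (t powr (- \<theta> * q 0) * K_functional j0 j1 t f powr q 0 / t) \<partial>lebesgue) (1 / q 0)
              + ennreal_powr (\<integral>\<^sup>+t\<in>{1<..}.
                  ennreal (t powr (- \<theta> * q_inf) * K_functional j0 j1 t f powr q_inf / t) \<partial>lebesgue) (1 / q_inf)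
        in ennreal c * I \<le> interp_norm j0 j1 \<theta> q f \<and> interp_norm j0 j1 \<theta> q f \<le> ennreal C * I)"
    (is "(\<exists>c>0. \<exists>C>0. \<forall>f\<in>_. ?dyadic c C f) \<and> (\<exists>c>0. \<exists>C>0. \<forall>f\<in>_. ?integral c C f)")
proof -
  have q: "1 \<le> q t" and q_meas: "q \<in> borel_measurable lebesgue" for t
    using assms by (auto simp: variable_exponents_def)
  have q_inf: "1 \<le> q_inf"
    using log_Hoelder_at_infinity_limit_ge_1[of q] q assms by blast
  obtain c1 where c1: "0 < c1" "\<And>x. \<bar>q x - q 0\<bar> \<le> c1 / ln (exp 1 + 1 / \<bar>x\<bar>)"
    using assms by (auto simp: log_Hoelder_at_origin_def)
  obtain c2 where c2: "0 < c2" "\<And>x. \<bar>q x - q_inf\<bar> \<le> c2 / ln (exp 1 + \<bar>x\<bar>)"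
    using assms by (auto simp: log_Hoelder_at_infinity_def)
  \<comment> \<open>One constant serves both log-Hoelder conditions, and it depends on
    \<open>q\<close> and \<open>q_inf\<close> only.\<close>
  define c where "c = max c1 c2"
  have ln_nonneg: "0 \<le> ln (exp 1 + x)" if "0 \<le> x" for x :: real
    using that exp_ge_add_one_self[of 1] by (intro ln_ge_zero) linarith
  have "c1 / ln (exp 1 + 1 / \<bar>x\<bar>) \<le> c / ln (exp 1 + 1 / \<bar>x\<bar>)" for x
    by (intro divide_right_mono ln_nonneg) (auto simp: c_def)
  then have origin: "\<bar>q x - q 0\<bar> \<le> c / ln (exp 1 + 1 / \<bar>x\<bar>)" for x
    using c1(2) order_trans by blast
  have "c2 / ln (exp 1 + \<bar>x\<bar>) \<le> c / ln (exp 1 + \<bar>x\<bar>)" for x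
    by (intro divide_right_mono ln_nonneg) (auto simp: c_def)
  then have infinity: "\<bar>q x - q_inf\<bar> \<le> c / ln (exp 1 + \<bar>x\<bar>)" for x
    using c2(2) order_trans by blast
  have "0 \<le> c" using c1(1) by (simp add: c_def)
  define D where "D = 2 * (exp (3 * c) + 1)"
  have D: "0 < D" by (simp add: D_def add_pos_pos)
  \<comment> \<open>The constants are fixed before \<open>f\<close> and are therefore independent of
    it. \<open>D\<close> comes from the exponent change, the extra 4 from comparing dyadic sums with
    integrals.\<close>
  have main: "?dyadic (1 / (4 * D)) (4 * D) f \<and> ?integral (1 / D) D f"
    if "f \<in> interp_space j0 j1 \<theta> q" for f
  proof -
    have f: "f \<in> couple_sum j0 j1" using that by (simp add: interp_space_def)
    define g where "g = weighted_K j0 j1 \<theta> f"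
    note g = doubling_weighted_K[OF f assms(2,3), folded g_def]
    note g_meas = weighted_K_measurable[OF f, of \<theta>, folded g_def]
    have norm: "interp_norm j0 j1 \<theta> q f = Luxemburg_norm q g"
      unfolding interp_norm_def by (intro Luxemburg_norm_cong) (simp add: g_def weighted_K_def)
    have split: "split_norm (q 0) q_inf g =
        ennreal_powr (\<integral>\<^sup>+t\<in>{0<..<1}.
            ennreal (t powr (- \<theta> * q 0) * K_functional j0 j1 t f powr q 0 / t) \<partial>lebesgue) (1 / q 0)
        + ennreal_powr (\<integral>\<^sup>+t\<in>{1<..}.
            ennreal (t powr (- \<theta> * q_inf) * K_functional j0 j1 t f powr q_inf / t) \<partial>lebesgue) (1 / q_inf)"
      unfolding split_norm_def modular_def
      by (intro arg_cong2[where f = "(+)"] arg_cong2[where f = ennreal_powr] nn_integral_cong refl)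
        (auto simp: indicator_def g_def weighted_K_powr[OF f])
    have "g (2 powr real_of_int v) powr p
        = 2 powr (- real_of_int v * \<theta> * p) * K_functional j0 j1 (2 powr real_of_int v) f powr p" for v p
      by (simp add: g_def weighted_K_powr[OF f] powr_powr mult.assoc)
    then have dyadic: "dyadic_norm (q 0) q_inf g =
        ennreal_powr (\<Sum>\<^sub>\<infinity>v\<in>{..0::int}. ennreal (2 powr (- real_of_int v * \<theta> * q 0)
            * K_functional j0 j1 (2 powr real_of_int v) f powr q 0)) (1 / q 0)
        + ennreal_powr (\<Sum>\<^sub>\<infinity>v\<in>{1::int..}. ennreal (2 powr (- real_of_int v * \<theta> * q_inf)
            * K_functional j0 j1 (2 powr real_of_int v) f powr q_inf)) (1 / q_inf)"
      by (simp add: dyadic_norm_def)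
    have lower: "ennreal (1 / D) * split_norm (q 0) q_inf g \<le> Luxemburg_norm q g"
      and upper: "Luxemburg_norm q g \<le> ennreal D * split_norm (q 0) q_inf g"
      unfolding D_def using g g_meas q_meas q q_inf \<open>0 \<le> c\<close> origin infinity
      by (intro split_norm_le_Luxemburg_norm Luxemburg_norm_le_split_norm; simp)+
    have "ennreal (1 / (4 * D)) * dyadic_norm (q 0) q_inf g
        \<le> ennreal (1 / (4 * D)) * (ennreal 4 * split_norm (q 0) q_inf g)"
      using dyadic_norm_le_split_norm[OF g g_meas q q_inf] by (intro mult_left_mono) auto
    also have "\<dots> = ennreal (1 / D) * split_norm (q 0) q_inf g"
      using D by (simp flip: mult.assoc ennreal_mult del: ennreal_numeral)
    finally have dyadic_lower: "ennreal (1 / (4 * D)) * dyadic_norm (q 0) q_inf g \<le> Luxemburg_norm q g"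
      using lower by (rule order_trans)
    have "Luxemburg_norm q g \<le> ennreal D * (ennreal 4 * dyadic_norm (q 0) q_inf g)"
      using upper split_norm_le_dyadic_norm[OF g g_meas q q_inf]
      by (rule order_trans[OF _ mult_left_mono]) simp
    also have "\<dots> = ennreal (4 * D) * dyadic_norm (q 0) q_inf g"
      using D by (simp add: mult.commute[of 4] flip: mult.assoc ennreal_mult del: ennreal_numeral)
    finally show ?thesis
      using lower upper dyadic_lower unfolding Let_def norm split dyadic by blast
  qed
  show ?thesis
  proof
    show "\<exists>c>0. \<exists>C>0. \<forall>f\<in>interp_space j0 j1 \<theta> q. ?dyadic c C f"
      using main D by (intro exI[of _ "1 / (4 * D)"] exI[of _ "4 * D"] conjI) auto
    show "\<exists>c>0. \<exists>C>0. \<forall>f\<in>interp_space j0 j1 \<theta> q. ?integral c C f"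
      using main D by (intro exI[of _ "1 / D"] exI[of _ D] conjI) auto
  qed
qed

end
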